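(* Let $m, s$ be positive integers, $x = m/s$, and $n = \lfloor 2x \rfloor$, and suppose $n \ge 2$ and $2x$ is not an integer. Then (a) any optimal solution of the fully-constrained muffin problem for $(m,s)$ is an optimal solution of the supply-constrained muffin problem for $(m,s)$; and (b) there exists an optimal solution of the supply-constrained muffin problem for $(m,s)$ that is not feasible for the fully-constrained muffin problem for $(m,s)$ if and only if \[ \frac{n(n+2)}{2(n+1)} \le x < \frac{n+1}{2}. \]
   Context: The muffin problem with $m$ muffins and $s$ students asks to cut each of $m$ muffins of size $1$ into pieces of positive size and assign each piece to one of $s$ students so that every student receives total size $x = m/s$; the objective is to maximize the size of the smallest piece. The supply-constrained muffin problem additionally requires that each muffin be cut into exactly two pieces. The fully-constrained muffin problem additionally requires (besides each muffin being cut into exactly two pieces) that each student receive either $n$ or $n+1$ pieces, where $n = \lfloor 2m/s \rfloor$. A solution of either problem is optimal if it maximizes the smallest piece size among feasible solutions of that problem. *)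

theory Defs
  imports Complex_Main
begin

text \<open>A cutting of m muffins, each into exactly two pieces, is encoded by
  piece sizes p (i,j) and an assignment f (i,j) of piece j (j = 0,1) of muffin i
  (i < m) to a student in {0..<s}.\<close>

definition pieces :: "nat \<Rightarrow> (nat \<times> nat) set" where
  "pieces m = {0..<m} \<times> {0..<2}"

definition muffin_n :: "nat \<Rightarrow> nat \<Rightarrow> nat" where
  "muffin_n m s = nat \<lfloor>2 * real m / real s\<rfloor>"

definition supply_feasible ::
  "nat \<Rightarrow> nat \<Rightarrow> (nat \<times> nat \<Rightarrow> real) \<Rightarrow> (nat \<times> nat \<Rightarrow> nat) \<Rightarrow> bool" where
  "supply_feasible m s p f \<longleftrightarrow>
     (\<forall>i<m. p (i,0) + p (i,1) = 1) \<and>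
     (\<forall>q\<in>pieces m. p q > 0 \<and> f q < s) \<and>
     (\<forall>k<s. (\<Sum>q\<in>{q\<in>pieces m. f q = k}. p q) = real m / real s)"

definition fully_feasible ::
  "nat \<Rightarrow> nat \<Rightarrow> (nat \<times> nat \<Rightarrow> real) \<Rightarrow> (nat \<times> nat \<Rightarrow> nat) \<Rightarrow> bool" where
  "fully_feasible m s p f \<longleftrightarrow>
     supply_feasible m s p f \<and>
     (\<forall>k<s. card {q\<in>pieces m. f q = k} \<in> {muffin_n m s, muffin_n m s + 1})"

definition min_piece :: "nat \<Rightarrow> (nat \<times> nat \<Rightarrow> real) \<Rightarrow> real" where
  "min_piece m p = Min (p ` pieces m)"

definition supply_optimal ::
  "nat \<Rightarrow> nat \<Rightarrow> (nat \<times> nat \<Rightarrow> real) \<Rightarrow> (nat \<times> nat \<Rightarrow> nat) \<Rightarrow> bool" where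
  "supply_optimal m s p f \<longleftrightarrow> supply_feasible m s p f \<and>
     (\<forall>p' f'. supply_feasible m s p' f' \<longrightarrow> min_piece m p' \<le> min_piece m p)"

definition fully_optimal ::
  "nat \<Rightarrow> nat \<Rightarrow> (nat \<times> nat \<Rightarrow> real) \<Rightarrow> (nat \<times> nat \<Rightarrow> nat) \<Rightarrow> bool" where
  "fully_optimal m s p f \<longleftrightarrow> fully_feasible m s p f \<and>
     (\<forall>p' f'. fully_feasible m s p' f' \<longrightarrow> min_piece m p' \<le> min_piece m p)"

end

theory Submission
  imports Defs
begin

text \<open>
  Write \<open>x = m/s\<close>, \<open>n = \<lfloor>2m/s\<rfloor>\<close>, \<open>a = (n+1)s - 2m\<close> and \<open>b = 2m - ns\<close>. In a fully-constrained solution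
  exactly \<open>a\<close> students have \<open>n\<close> pieces and \<open>b\<close> students have \<open>n + 1\<close>. A muffin is an edge between the
  owners of its two pieces, and its cut a flow along that edge: the students with
  \<open>n\<close> pieces have to receive \<open>b/(2s)\<close> each and the others to send \<open>a/(2s)\<close> each. A flow bounded by \<open>C/(2s)\<close> on
  every edge gives smallest piece at least \<open>1/2 - C/(2s)\<close>.

  A student with at least \<open>n + 2\<close> pieces or at most \<open>n - 1\<close> pieces forces the smallest piece below
  \<open>x/(n+2)\<close> or \<open>1 - x/(n-1)\<close>. If \<open>b < na\<close>, there is a fully-constrained solution that beats both bounds.
  The condition \<open>na \<le> b\<close> is the inequality of part (b); then some student with at most \<open>n\<close> pieces
  always forces the bound \<open>1 - x/n\<close>, this bound is attained by a fully-constrained solution, and it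
  is also attained with a student who has \<open>n + 2\<close> pieces.

  Each flow is constant on the edges between the two classes; what remains is balanced along a
  cycle through suitable students, visited in a greedy order that keeps the partial sums in an
  interval as short as the spread of the residual demands. The unused ends are
  joined by muffins cut in half.
\<close>

subsection \<open>Muffins as edges of a flow network\<close>

type_synonym edge = "nat \<times> nat \<times> real"

text \<open>A loop counts twice: a student may own both pieces of one muffin, and \<open>deg\<close>
  has to count pieces. In \<open>net\<close> a loop cancels.\<close>

primrec deg :: "edge list \<Rightarrow> nat \<Rightarrow> nat" where
  "deg [] k = 0"
| "deg (e # es) k = of_bool (fst e = k) + of_bool (fst (snd e) = k) + deg es k"

primrec net :: "edge list \<Rightarrow> nat \<Rightarrow> real" where
  "net [] k = 0"
| "net (e # es) k = (of_bool (fst e = k) - of_bool (fst (snd e) = k)) * snd (snd e) + net es k"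

definition edges_on :: "nat \<Rightarrow> real \<Rightarrow> edge list \<Rightarrow> bool" where
  "edges_on s c es \<longleftrightarrow> (\<forall>e\<in>set es. fst e < s \<and> fst (snd e) < s \<and> \<bar>snd (snd e)\<bar> \<le> c)"

lemma deg_append [simp]: "deg (xs @ ys) k = deg xs k + deg ys k"
  by (induction xs) auto

lemma net_append [simp]: "net (xs @ ys) k = net xs k + net ys k"
  by (induction xs) auto

lemma edges_on_append [simp]: "edges_on s c (xs @ ys) \<longleftrightarrow> edges_on s c xs \<and> edges_on s c ys"
  by (auto simp: edges_on_def)

lemma edges_on_mono: "edges_on s c es \<Longrightarrow> c \<le> c' \<Longrightarrow> edges_on s c' es"
  by (force simp: edges_on_def)

lemma sum_deg: "edges_on s c es \<Longrightarrow> (\<Sum>k<s. deg es k) = 2 * length es"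
proof (induction es)
  case (Cons e es)
  then have "edges_on s c es" and l: "fst e < s" "fst (snd e) < s"
    by (auto simp: edges_on_def)
  moreover have "(\<Sum>k<s. of_bool (u = k)) = (1::nat)" if "u < s" for u
    using that by (simp add: of_bool_def)
  ultimately show ?case
    using Cons.IH by (simp add: sum.distrib)
qed simp

lemma deg_conv_sum:
  "deg es k = (\<Sum>i<length es. of_bool (fst (es ! i) = k) + of_bool (fst (snd (es ! i)) = k))"
  by (induction es) (auto simp: lessThan_Suc_eq_insert_0 sum.reindex simp del: sum.lessThan_Suc)

lemma net_conv_sum:
  "net es k = (\<Sum>i<length es. (of_bool (fst (es ! i) = k) - of_bool (fst (snd (es ! i)) = k)) * snd (snd (es ! i)))"
  by (induction es) (auto simp: lessThan_Suc_eq_insert_0 sum.reindex simp del: sum.lessThan_Suc)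

lemma sum_pieces: "(\<Sum>q\<in>pieces m. h q) = (\<Sum>i<m. h (i, 0) + h (i, Suc 0))"
proof -
  have "(\<Sum>q\<in>pieces m. h q) = (\<Sum>i<m. \<Sum>j\<in>{0..<2}. h (i, j))"
    by (simp add: pieces_def sum.cartesian_product lessThan_atLeast0)
  then show ?thesis by (simp add: numeral_2_eq_2)
qed

lemma finite_pieces [simp]: "finite (pieces m)"
  by (simp add: pieces_def)

lemma pieces_nonempty: "m > 0 \<Longrightarrow> pieces m \<noteq> {}"
  by (auto simp: pieces_def)

lemma sum_at_student:
  fixes h :: "nat \<times> nat \<Rightarrow> 'a :: semiring_1"
  shows "(\<Sum>q\<in>{q\<in>pieces m. f q = k}. h q) = (\<Sum>q\<in>pieces m. of_bool (f q = k) * h q)"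
  by (simp add: sum.inter_filter of_bool_def if_distrib[of "\<lambda>c. c * _"] cong: if_cong)

lemma card_at_student:
  "card {q\<in>pieces m. f q = k} = (\<Sum>q\<in>pieces m. of_bool (f q = k))"
  using sum_at_student[where h = "\<lambda>_. 1::nat"] by simp

text \<open>An edge \<open>(u, v, g)\<close> stands for a muffin cut into a piece \<open>1/2 - g/(2s)\<close> for
  student \<open>u\<close> and a piece \<open>1/2 + g/(2s)\<close> for student \<open>v\<close>.\<close>

lemma solution_of_edges:
  assumes "m > 0" and "s > 0" and len: "length es = m" and on: "edges_on s c es" and "c < s"
    and net: "\<And>k. k < s \<Longrightarrow> net es k = real s * deg es k - 2 * real m"
  shows "\<exists>p f. supply_feasible m s p f \<and> (\<forall>k<s. card {q\<in>pieces m. f q = k} = deg es k)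
    \<and> 1/2 - c / (2 * real s) \<le> min_piece m p"
proof -
  define g where "g i = snd (snd (es ! i)) / (2 * real s)" for i
  define p where "p = (\<lambda>(i, j). if j = (0::nat) then 1/2 - g i else 1/2 + g i)"
  define f where "f = (\<lambda>(i, j). if j = (0::nat) then fst (es ! i) else fst (snd (es ! i)))"
  have g: "\<bar>g i\<bar> \<le> c / (2 * real s)" and uv: "fst (es ! i) < s" "fst (snd (es ! i)) < s" if "i < m" for i
  proof -
    have "es ! i \<in> set es" using that len by simp
    then have "\<bar>snd (snd (es ! i))\<bar> \<le> c \<and> fst (es ! i) < s \<and> fst (snd (es ! i)) < s"
      using on by (auto simp: edges_on_def)
    then show "\<bar>g i\<bar> \<le> c / (2 * real s)" "fst (es ! i) < s" "fst (snd (es ! i)) < s"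
      using \<open>s > 0\<close> by (auto simp: g_def abs_divide divide_right_mono)
  qed
  have lb: "1/2 - c / (2 * real s) \<le> p q" if "q \<in> pieces m" for q
    using that g[of "fst q"] by (auto simp: p_def pieces_def abs_le_iff split: if_splits)
  have pos: "1/2 - c / (2 * real s) > 0"
    using \<open>c < s\<close> \<open>s > 0\<close> by (simp add: field_simps)
  have card: "card {q\<in>pieces m. f q = k} = deg es k" for k
    by (simp add: card_at_student sum_pieces f_def deg_conv_sum len)
  have tot: "(\<Sum>q\<in>{q\<in>pieces m. f q = k}. p q) = real m / real s" if "k < s" for k
  proof -
    have "(\<Sum>q\<in>{q\<in>pieces m. f q = k}. p q)
        = (\<Sum>i<m. of_bool (fst (es ! i) = k) * (1/2 - g i) + of_bool (fst (snd (es ! i)) = k) * (1/2 + g i))"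
      by (simp only: sum_at_student sum_pieces) (simp add: p_def f_def)
    also have "\<dots> = (\<Sum>i<m. real (of_bool (fst (es ! i) = k) + of_bool (fst (snd (es ! i)) = k)) / 2
        - ((of_bool (fst (es ! i) = k) - of_bool (fst (snd (es ! i)) = k)) * snd (snd (es ! i))) / (2 * real s))"
      by (rule sum.cong) (auto simp: g_def)
    \<comment> \<open>Each end contributes one half, corrected by the net flow in units of
      \<open>1/(2s)\<close>; the value required of \<open>net\<close> turns this into
      \<open>m/s\<close>.\<close>
    also have "\<dots> = real (deg es k) / 2 - net es k / (2 * real s)"
      unfolding sum_subtractf sum_divide_distrib[symmetric] deg_conv_sum net_conv_sum len of_nat_sum ..
    also have "\<dots> = m / s"
      unfolding net[OF that] using \<open>s > 0\<close> by (simp add: field_simps)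
    finally show ?thesis .
  qed
  have "supply_feasible m s p f"
    unfolding supply_feasible_def
  proof (intro conjI allI impI ballI)
    fix q assume q: "q \<in> pieces m"
    show "p q > 0" using lb[OF q] pos by linarith
    show "f q < s" using q uv by (auto simp: f_def pieces_def)
  qed (use tot in \<open>auto simp: p_def\<close>)
  moreover have "1/2 - c / (2 * real s) \<le> min_piece m p"
    unfolding min_piece_def using lb pieces_nonempty[OF \<open>m > 0\<close>] by (intro Min.boundedI) auto
  ultimately show ?thesis using card by blast
qed

section \<open>Edges with prescribed degrees\<close>

lemma stub_list:
  fixes s :: nat
  shows "\<exists>xs. set xs \<subseteq> {..<s} \<and> (\<forall>k<s. count_list xs k = R k) \<and> length xs = (\<Sum>k<s. R k)"
proof (induction s)
  case (Suc s)
  then obtain xs where xs: "set xs \<subseteq> {..<s}" "\<forall>k<s. count_list xs k = R k" "length xs = (\<Sum>k<s. R k)"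
    by blast
  have "count_list xs s = 0" using xs(1) by (auto simp: count_list_0_iff)
  moreover have "count_list (replicate i j) k = (if j = k then i else 0)" for i j k :: nat
    by (induction i) auto
  ultimately show ?case
    using xs by (intro exI[of _ "xs @ replicate (R s) s"]) (auto simp: less_Suc_eq)
qed simp

lemma zip_edges:
  assumes "length xs = length ys" and "set xs \<subseteq> {..<s}" and "set ys \<subseteq> {..<s}"
  shows "\<exists>es. edges_on s \<bar>t\<bar> es \<and> length es = length xs
    \<and> (\<forall>k. deg es k = count_list xs k + count_list ys k)
    \<and> (\<forall>k. net es k = t * (real (count_list xs k) - real (count_list ys k)))"
  using assms
proof (induction xs ys rule: list_induct2)
  case Nil
  then show ?case by (intro exI[of _ "[]"]) (auto simp: edges_on_def)
next
  case (Cons x xs y ys)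
  then obtain es where "edges_on s \<bar>t\<bar> es \<and> length es = length xs
    \<and> (\<forall>k. deg es k = count_list xs k + count_list ys k)
    \<and> (\<forall>k. net es k = t * (real (count_list xs k) - real (count_list ys k)))"
    by auto
  with Cons.prems show ?case
    by (intro exI[of _ "(x, y, t) # es"]) (auto simp: edges_on_def algebra_simps)
qed

text \<open>Outgoing and incoming ends are listed with multiplicity and paired position by position.
  Loops and parallel edges are harmless, so only the totals must agree.\<close>

lemma edges_with_degrees:
  assumes "(\<Sum>k<s. out k) = (\<Sum>k<s. inn k)" and "t \<ge> 0"
  obtains es where "edges_on s t es" "\<And>k. k < s \<Longrightarrow> deg es k = out k + inn k"
    "\<And>k. k < s \<Longrightarrow> net es k = t * (real (out k) - real (inn k))"
proof -
  obtain xs where xs: "set xs \<subseteq> {..<s}" "\<forall>k<s. count_list xs k = out k" "length xs = (\<Sum>k<s. out k)"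
    using stub_list by blast
  obtain ys where ys: "set ys \<subseteq> {..<s}" "\<forall>k<s. count_list ys k = inn k" "length ys = (\<Sum>k<s. inn k)"
    using stub_list by blast
  have "length xs = length ys" using xs(3) ys(3) assms(1) by simp
  from zip_edges[OF this xs(1) ys(1), of t] obtain es where "edges_on s t es"
    "\<forall>k. deg es k = count_list xs k + count_list ys k"
    "\<forall>k. net es k = t * (real (count_list xs k) - real (count_list ys k))"
    unfolding abs_of_nonneg[OF \<open>t \<ge> 0\<close>] by blast
  with xs ys show ?thesis by (intro that[of es]) simp_all
qed

text \<open>The number of free ends is even. Pairing one half of their list with the other at flow 0
  leaves \<open>net\<close> unchanged.\<close>

lemma fill_edges:
  assumes on: "edges_on s c es" and le: "\<And>k. k < s \<Longrightarrow> deg es k \<le> D k"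
    and D: "(\<Sum>k<s. D k) = 2 * m" and "c \<ge> 0"
  obtains es' where "edges_on s c es'" "length es' = m" "\<And>k. k < s \<Longrightarrow> deg es' k = D k"
    "\<And>k. net es' k = net es k"
proof -
  obtain xs where xs: "set xs \<subseteq> {..<s}" "\<forall>k<s. count_list xs k = D k - deg es k"
    "length xs = (\<Sum>k<s. D k - deg es k)"
    using stub_list[of s "\<lambda>k. D k - deg es k"] by blast
  have "length xs + (\<Sum>k<s. deg es k) = 2 * m"
    unfolding xs(3) D[symmetric] sum.distrib[symmetric] using le by (intro sum.cong) auto
  then have len: "length xs = 2 * (m - length es)" "length es \<le> m"
    using sum_deg[OF on] by auto
  define ys zs where "ys = take (m - length es) xs" and "zs = drop (m - length es) xs"
  have xs_eq: "xs = ys @ zs" by (simp add: ys_def zs_def)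
  then have sets: "set ys \<subseteq> {..<s}" "set zs \<subseteq> {..<s}" using xs(1) by auto
  have lens: "length ys = m - length es" "length ys = length zs"
    using len by (auto simp: ys_def zs_def)
  obtain fs where fs: "edges_on s 0 fs" "length fs = m - length es"
    "\<And>k. deg fs k = count_list ys k + count_list zs k" "\<And>k. net fs k = 0"
    using zip_edges[OF lens(2) sets, of 0] lens(1) unfolding abs_zero mult_zero_left by metis
  show ?thesis
  proof (rule that)
    show "edges_on s c (es @ fs)" 
      using on edges_on_mono[OF fs(1) \<open>c \<ge> 0\<close>] by simp
    show "length (es @ fs) = m" using fs(2) len by simp
    show "deg (es @ fs) k = D k" if "k < s" for k
      using that fs(3)[of k] xs(2) le[of k] by (simp add: xs_eq)
  qed (simp add: fs(4))
qed

section \<open>Balancing along a cycle\<close>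

text \<open>The shift \<open>h\<close> only affects the ends \<open>a\<close> and \<open>z\<close>, which are identified later.\<close>

lemma greedy_path:
  assumes "finite W" and "sum d W = - S" and "- V < S" and "S \<le> U"
    and "\<And>w. w \<in> W \<Longrightarrow> - V \<le> d w \<and> d w \<le> U"
  shows "\<exists>es. (\<forall>(u, v, g) \<in> set es. u \<in> insert a W \<and> v \<in> insert z W \<and> - V < g \<and> g \<le> U)
    \<and> (\<forall>k. deg es k = 2 * of_bool (k \<in> W) + of_bool (k = a) + of_bool (k = z))
    \<and> (\<forall>h k. net (map (\<lambda>(u, v, g). (u, v, g + h)) es) k
        = of_bool (k \<in> W) * d k + of_bool (k = a) * (S + h) - of_bool (k = z) * (h::real))"
  using assms
proof (induction "card W" arbitrary: W S a)
  case 0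
  then have "W = {}" "S = 0" by auto
  then show ?case using 0 by (intro exI[of _ "[(a, z, 0)]"]) auto
next
  case (Suc N)
  \<comment> \<open>A step against the sign of the current partial sum \<open>S\<close> stays in the
    interval; a suitable \<open>w\<close> exists because the remaining demands sum to
    \<open>- S\<close>.\<close>
  have "\<exists>w\<in>W. - V < S + d w \<and> S + d w \<le> U"
  proof (cases "S \<le> 0")
    case True
    have "\<exists>w\<in>W. d w \<ge> 0"
    proof (rule ccontr)
      assume "\<not> ?thesis"
      then have "sum d W < 0"
        using Suc sum_strict_mono[of W d "\<lambda>_. 0"] by (cases "W = {}") (auto simp: not_le)
      then show False using Suc True by simp
    qed
    then show ?thesis using Suc.prems True by force
  next
    case False
    have "\<exists>w\<in>W. d w < 0"
    proof (rule ccontr)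
      assume "\<not> ?thesis"
      then have "sum d W \<ge> 0" by (intro sum_nonneg) (auto simp: not_less)
      then show False using Suc False by simp
    qed
    then show ?thesis using Suc.prems False by force
  qed
  then obtain w where w: "w \<in> W" "- V < S + d w" "S + d w \<le> U" by blast
  define W' where "W' = W - {w}"
  have W': "W = insert w W'" "w \<notin> W'" "finite W'" using w Suc.prems by (auto simp: W'_def)
  have "\<exists>es. (\<forall>(u, v, g) \<in> set es. u \<in> insert w W' \<and> v \<in> insert z W' \<and> - V < g \<and> g \<le> U)
    \<and> (\<forall>k. deg es k = 2 * of_bool (k \<in> W') + of_bool (k = w) + of_bool (k = z))
    \<and> (\<forall>h k. net (map (\<lambda>(u, v, g). (u, v, g + h)) es) k
        = of_bool (k \<in> W') * d k + of_bool (k = w) * (S + d w + h) - of_bool (k = z) * h)"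
    using Suc.hyps(2) Suc.prems w W' by (intro Suc.hyps(1)) auto
  then obtain es where es: "\<forall>(u, v, g) \<in> set es. u \<in> insert w W' \<and> v \<in> insert z W' \<and> - V < g \<and> g \<le> U"
    "\<And>k. deg es k = 2 * of_bool (k \<in> W') + of_bool (k = w) + of_bool (k = z)"
    "\<And>h k. net (map (\<lambda>(u, v, g). (u, v, g + h)) es) k
        = of_bool (k \<in> W') * d k + of_bool (k = w) * (S + d w + h) - of_bool (k = z) * h"
    by blast
  show ?case
  proof (intro exI[of _ "(a, w, S) # es"] conjI allI)
    show "\<forall>(u, v, g) \<in> set ((a, w, S) # es). u \<in> insert a W \<and> v \<in> insert z W \<and> - V < g \<and> g \<le> U"
      using es(1) Suc.prems W' by auto
    show "deg ((a, w, S) # es) k = 2 * of_bool (k \<in> W) + of_bool (k = a) + of_bool (k = z)" for k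
      using W' by (auto simp: es(2))
    show "net (map (\<lambda>(u, v, g). (u, v, g + h)) ((a, w, S) # es)) k
        = of_bool (k \<in> W) * d k + of_bool (k = a) * (S + h) - of_bool (k = z) * h" for h k
      unfolding list.map net.simps es(3)[of h k] using W'(1,2)
      by (cases "k = w"; cases "k = a") (simp_all add: algebra_simps)
  qed
qed


text \<open>The partial sums along the greedy order lie in \<open>]-V, U]\<close>; since the path is closed, a constant
  may be added to the flow, and centring that interval halves its bound.\<close>

lemma balancing_cycle:
  assumes "finite W" and "sum d W = 0" and "\<And>w. w \<in> W \<Longrightarrow> - V \<le> d w \<and> d w \<le> U"
    and "U \<ge> 0" and "V \<ge> 0" and "U + V > 0"
  shows "\<exists>es c. (\<forall>(u, v, g) \<in> set es. u \<in> W \<and> v \<in> W \<and> \<bar>g\<bar> \<le> c) \<and> 2 * c < U + V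
    \<and> (\<forall>k. deg es k = 2 * of_bool (k \<in> W)) \<and> (\<forall>k. net es k = of_bool (k \<in> W) * (d k :: real))"
proof -
  \<comment> \<open>The bounds are generalised so that the case \<open>V = 0\<close> can swap them:
    the starting value \<open>d w \<ge> 0\<close> must lie strictly above
    \<open>- V'\<close>.\<close>
  have main: ?thesis if "W \<noteq> {}" "V' > 0" "U' + V' = U + V"
     and d: "\<And>w. w \<in> W \<Longrightarrow> - V' \<le> d w \<and> d w \<le> U'" for U' V'
  proof -
    have "\<exists>w\<in>W. d w \<ge> 0"
    proof (rule ccontr)
      assume "\<not> ?thesis"
      then have "sum d W < 0"
        using assms(1) that(1) sum_strict_mono[of W d "\<lambda>_. 0"] by (auto simp: not_le)
      then show False using assms by simp
    qed
    then obtain w where w: "w \<in> W" "d w \<ge> 0" by blast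
    define W' where "W' = W - {w}"
    have W': "W = insert w W'" "w \<notin> W'" "finite W'" using w assms by (auto simp: W'_def)
    have "\<exists>es. (\<forall>(u, v, g) \<in> set es. u \<in> insert w W' \<and> v \<in> insert w W' \<and> - V' < g \<and> g \<le> U')
      \<and> (\<forall>k. deg es k = 2 * of_bool (k \<in> W') + of_bool (k = w) + of_bool (k = w))
      \<and> (\<forall>h k. net (map (\<lambda>(u, v, g). (u, v, g + h)) es) k
          = of_bool (k \<in> W') * d k + of_bool (k = w) * (d w + h) - of_bool (k = w) * h)"
      using w W' assms(2) that(2) d by (intro greedy_path) force+
    then obtain es where es: "\<forall>(u, v, g) \<in> set es. u \<in> W \<and> v \<in> W \<and> - V' < g \<and> g \<le> U'"
      "\<And>k. deg es k = 2 * of_bool (k \<in> W') + of_bool (k = w) + of_bool (k = w)"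
      "\<And>h k. net (map (\<lambda>(u, v, g). (u, v, g + h)) es) k
          = of_bool (k \<in> W') * d k + of_bool (k = w) * (d w + h) - of_bool (k = w) * h"
      unfolding W'(1) by blast
    \<comment> \<open>Finitely many flows strictly above \<open>- V'\<close> have a least one, so
      \<open>lo\<close> to \<open>U'\<close> is shorter than \<open>U + V\<close>; hence the strict
      bound on \<open>c\<close>. Including \<open>U'\<close> keeps the set nonempty.\<close>
    define lo where "lo = Min (insert U' ((\<lambda>(u, v, g). g) ` set es))"
    have "- V' < U'" using \<open>U' + V' = U + V\<close> \<open>U + V > 0\<close> by linarith
    then have "- V' < lo" unfolding lo_def using es(1) by (subst Min_gr_iff) auto
    have lo: "lo \<le> g" if "(u, v, g) \<in> set es" for u v g
      unfolding lo_def using that by (intro Min_le) force+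
    define h where "h = - (U' + lo) / 2"
    define fs where "fs = map (\<lambda>(u, v, g). (u, v, g + h)) es"
    have "\<forall>(u, v, g) \<in> set fs. u \<in> W \<and> v \<in> W \<and> \<bar>g\<bar> \<le> (U' - lo) / 2"
      using es(1) lo by (force simp: fs_def h_def abs_le_iff field_simps)
    moreover have "2 * ((U' - lo) / 2) < U + V"
      using \<open>- V' < lo\<close> \<open>U' + V' = U + V\<close> by simp
    moreover have "deg (map (\<lambda>(u, v, g). (u, v, g + h)) es) k = deg es k" for k
      by (induction es) auto
    then have "\<forall>k. deg fs k = 2 * of_bool (k \<in> W)"
      using W' by (auto simp: fs_def es(2))
    moreover have "\<forall>k. net fs k = of_bool (k \<in> W) * d k"
      unfolding fs_def es(3) using W' by auto
    ultimately show ?thesis by blast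
  qed
  consider "W = {}" | "W \<noteq> {}" "V > 0" | "W \<noteq> {}" "V = 0" using assms by linarith
  then show ?thesis
  proof cases
    case 1
    then show ?thesis using assms by (intro exI[of _ "[]"] exI[of _ 0]) auto
  next
    case 2
    then show ?thesis using main assms by blast
  next
    case 3
    then have "d w = 0" if "w \<in> W" for w
      using assms that sum_nonneg_eq_0_iff[of W d] by auto
    then show ?thesis using 3 assms main[of U 0] by simp
  qed
qed

section \<open>Solutions from a base flow and a cycle\<close>

lemma sum_net: "edges_on s c es \<Longrightarrow> (\<Sum>k<s. net es k) = 0"
proof (induction es)
  case (Cons e es)
  then have "edges_on s c es" and l: "fst e < s" "fst (snd e) < s"
    by (auto simp: edges_on_def)
  moreover have "(\<Sum>k<s. of_bool (u = k)) = (1::real)" if "u < s" for u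
    using that by (simp add: of_bool_def)
  ultimately show ?case
    using Cons.IH by (simp add: sum.distrib sum_subtractf flip: sum_distrib_right)
qed simp

text \<open>The base edges \<open>es\<close> meet the demand \<open>s * D k - 2 * m\<close> of every
  student outside \<open>W\<close>. Students in \<open>W\<close> keep two free ends for a cycle that
  carries their residual demands; these sum to 0, since the demands and the values of
  \<open>net\<close> both do. The bounds \<open>t < s\<close> and \<open>U + V \<le> 2 * s\<close>
  keep all pieces positive.\<close>

lemma solution_with_cycle:
  fixes t U V :: real
  assumes "m > 0" and "s > 0" and D: "(\<Sum>k<s. D k) = 2 * m"
    and on: "edges_on s t es" and "0 \<le> t" and "t < s" and W: "W \<subseteq> {..<s}"
    and deg: "\<And>k. k < s \<Longrightarrow> deg es k + 2 * of_bool (k \<in> W) \<le> D k"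
    and W_net: "\<And>k. k \<in> W \<Longrightarrow> - V \<le> real s * D k - 2 * real m - net es k
       \<and> real s * D k - 2 * real m - net es k \<le> U"
    and nW_net: "\<And>k. k < s \<Longrightarrow> k \<notin> W \<Longrightarrow> net es k = real s * D k - 2 * real m"
    and UV: "U \<ge> 0" "V \<ge> 0" "0 < U + V" "U + V \<le> 2 * real s"
  shows "\<exists>p f c. supply_feasible m s p f \<and> (\<forall>k<s. card {q\<in>pieces m. f q = k} = D k)
    \<and> 2 * c < U + V \<and> 1/2 - max t c / (2 * real s) \<le> min_piece m p"
proof -
  define d where "d k = real s * D k - 2 * real m - net es k" for k
  have "sum d {..<s} = real s * (\<Sum>k<s. D k) - s * (2 * real m)"
    using sum_net[OF on] by (simp add: d_def sum_subtractf sum_distrib_left)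
  then have "sum d {..<s} = 0" using D by simp
  moreover have "sum d W = sum d {..<s}"
    using W nW_net by (intro sum.mono_neutral_left) (auto simp: d_def)
  ultimately obtain cs c where cs: "\<forall>(u, v, g) \<in> set cs. u \<in> W \<and> v \<in> W \<and> \<bar>g\<bar> \<le> c" "2 * c < U + V"
    "\<forall>k. deg cs k = 2 * of_bool (k \<in> W)" "\<forall>k. net cs k = of_bool (k \<in> W) * d k"
    using balancing_cycle[of W d V U] W_net UV finite_subset[OF W] by (auto simp: d_def)
  have "edges_on s c cs" using cs(1) W by (force simp: edges_on_def)
  then have on': "edges_on s (max t c) (es @ cs)"
    using on by (auto intro: edges_on_mono)
  have deg': "deg (es @ cs) k \<le> D k" if "k < s" for k
    using deg[OF that] cs(3) by simp
  obtain fs where fs: "edges_on s (max t c) fs" "length fs = m"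
    "\<And>k. k < s \<Longrightarrow> deg fs k = D k" "\<And>k. net fs k = net (es @ cs) k"
    using fill_edges[OF on' deg' D max.coboundedI1[OF \<open>0 \<le> t\<close>]] by blast
  have "net fs k = real s * deg fs k - 2 * real m" if "k < s" for k
    using nW_net that cs(4) by (simp add: fs d_def)
  moreover have "max t c < s" using cs(2) UV \<open>t < s\<close> by auto
  ultimately obtain p f where "supply_feasible m s p f" "\<forall>k<s. card {q\<in>pieces m. f q = k} = deg fs k"
    "1/2 - max t c / (2 * real s) \<le> min_piece m p"
    using solution_of_edges[OF assms(1,2) fs(2,1)] by blast
  then show ?thesis using fs(3) cs(2) by (intro exI[of _ p] exI[of _ f] exI[of _ c]) auto
qed

lemma solution_of_degrees:
  fixes t U V :: real
  assumes "m > 0" and "s > 0" and D: "(\<Sum>k<s. D k) = 2 * m"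
    and io: "(\<Sum>k<s. out k) = (\<Sum>k<s. inn k)" and "0 \<le> t" and "t < s" and W: "W \<subseteq> {..<s}"
    and deg: "\<And>k. k < s \<Longrightarrow> out k + inn k + 2 * of_bool (k \<in> W) \<le> D k"
    and W_net: "\<And>k. k \<in> W \<Longrightarrow> - V \<le> real s * D k - 2 * real m - t * (real (out k) - real (inn k))
       \<and> real s * D k - 2 * real m - t * (real (out k) - real (inn k)) \<le> U"
    and nW_net: "\<And>k. k < s \<Longrightarrow> k \<notin> W \<Longrightarrow> t * (real (out k) - real (inn k)) = real s * D k - 2 * real m"
    and UV: "U \<ge> 0" "V \<ge> 0" "0 < U + V" "U + V \<le> 2 * real s"
  shows "\<exists>p f c. supply_feasible m s p f \<and> (\<forall>k<s. card {q\<in>pieces m. f q = k} = D k)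
    \<and> 2 * c < U + V \<and> 1/2 - max t c / (2 * real s) \<le> min_piece m p"
proof -
  obtain es where es: "edges_on s t es" "\<And>k. k < s \<Longrightarrow> deg es k = out k + inn k"
    "\<And>k. k < s \<Longrightarrow> net es k = t * (real (out k) - real (inn k))"
    using edges_with_degrees io \<open>0 \<le> t\<close> by blast
  have "k < s" if "k \<in> W" for k using W that by auto
  then show ?thesis
    using assms es
    by (intro solution_with_cycle[OF assms(1-3) es(1) \<open>0 \<le> t\<close> \<open>t < s\<close> W, of V U]) simp_all
qed

section \<open>Upper bounds on the smallest piece\<close>

lemma min_piece_le: "q \<in> pieces m \<Longrightarrow> min_piece m p \<le> p q"
  by (simp add: min_piece_def)

lemma min_piece_upper:
  assumes "supply_feasible m s p f" and "q \<in> pieces m"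
  shows "p q \<le> 1 - min_piece m p"
proof -
  obtain i j where q: "q = (i, j)" "i < m" "j = 0 \<or> j = 1"
    using assms by (auto simp: pieces_def less_2_cases_iff)
  then have "p (i, 0) + p (i, 1) = 1" "(i, 1 - j) \<in> pieces m" "p (i, j) + p (i, 1 - j) = p (i, 0) + p (i, 1)"
    using assms by (auto simp: pieces_def supply_feasible_def)
  then show ?thesis using min_piece_le[of "(i, 1 - j)" m p] by (simp add: q(1))
qed

text \<open>The share \<open>m / s\<close> is at least the number of pieces times the minimum; as
  the minimum is positive, that number may be lowered to \<open>N\<close>.\<close>

lemma min_piece_many_pieces:
  assumes "supply_feasible m s p f" and "k < s" and "N > 0" and N: "N \<le> card {q\<in>pieces m. f q = k}"
    and "m > 0"
  shows "min_piece m p \<le> real m / s / N"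
proof -
  have pos: "min_piece m p > 0"
    unfolding min_piece_def using assms pieces_nonempty by (subst Min_gr_iff) (auto simp: supply_feasible_def)
  have "N * min_piece m p \<le> card {q\<in>pieces m. f q = k} * min_piece m p"
    using N pos by (intro mult_right_mono) auto
  also have "\<dots> \<le> (\<Sum>q\<in>{q\<in>pieces m. f q = k}. p q)"
    by (intro sum_bounded_below) (auto intro: min_piece_le)
  also have "\<dots> = real m / s" using assms by (auto simp: supply_feasible_def)
  finally show ?thesis using \<open>N > 0\<close> by (simp add: field_simps del: of_nat_mult divide_divide_eq_left divide_divide_eq_left')
qed

text \<open>Dual averaging: no piece exceeds 1 minus the minimum, because of the other piece of its
  muffin.\<close>

lemma min_piece_few_pieces:
  assumes "supply_feasible m s p f" and "k < s" and "N > 0" and N: "card {q\<in>pieces m. f q = k} \<le> N"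
    and "m > 0"
  shows "min_piece m p \<le> 1 - real m / s / N"
proof -
  obtain q where q: "q \<in> pieces m" using pieces_nonempty[OF \<open>m > 0\<close>] by auto
  have pos: "1 - min_piece m p > 0"
    using min_piece_upper[OF assms(1) q] assms(1) q by (force simp: supply_feasible_def)
  have "real m / s = (\<Sum>q\<in>{q\<in>pieces m. f q = k}. p q)"
    using assms by (auto simp: supply_feasible_def)
  also have "\<dots> \<le> card {q\<in>pieces m. f q = k} * (1 - min_piece m p)"
    by (intro sum_bounded_above) (auto intro: min_piece_upper[OF assms(1)])
  also have "\<dots> \<le> N * (1 - min_piece m p)"
    using N pos by (intro mult_right_mono) auto
  finally show ?thesis using \<open>N > 0\<close> by (simp add: field_simps del: of_nat_mult divide_divide_eq_left divide_divide_eq_left')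
qed

lemma sum_card_at_students:
  assumes "supply_feasible m s p f"
  shows "(\<Sum>k<s. card {q\<in>pieces m. f q = k}) = 2 * m"
proof -
  have "(\<Sum>k<s. card {q\<in>pieces m. f q = k}) = card (\<Union>k<s. {q\<in>pieces m. f q = k})"
    by (subst card_UN_disjoint) auto
  also have "(\<Union>k<s. {q\<in>pieces m. f q = k}) = pieces m"
    using assms by (auto simp: supply_feasible_def)
  finally show ?thesis by (simp add: pieces_def)
qed

subsection \<open>Solutions with prescribed numbers of pieces\<close>

lemma sum_if_less:
  fixes l i n :: nat
  shows "(\<Sum>k\<in>{l..<n}. if k < i then F k else G k) = sum F {l..<min i n} + (sum G {max l i..<n} :: nat)"
proof -
  have "{l..<n} \<inter> {k. k < i} = {l..<min i n}" "{l..<n} \<inter> - {k. k < i} = {max l i..<n}" by auto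
  then show ?thesis by (simp add: sum.If_cases)
qed

text \<open>Sharing \<open>E\<close> ends among \<open>c\<close> students gives \<open>q + 1\<close>
  to \<open>R\<close> of them and \<open>q\<close> to the others. With \<open>R > 0\<close> the
  larger share does occur, and \<open>q + 1\<close> is the ceiling of \<open>E / c\<close>.\<close>

lemma even_distribution:
  fixes E c :: nat
  assumes "E > 0" and "c > 0"
  obtains q R where "E = q * c + R" "0 < R" "R \<le> c"
proof
  show "E = (E - 1) div c * c + ((E - 1) mod c + 1)" using assms by simp
  show "0 < (E - 1) mod c + 1" by simp
  show "(E - 1) mod c + 1 \<le> c" using assms by (simp add: Suc_leI)
qed

locale muffin_numbers =
  fixes m s n a b :: nat
  assumes n: "n \<ge> 2" and a: "a > 0" and b: "b > 0" and s: "s = a + b"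
    and m: "2 * m = n * a + (n + 1) * b"
begin

lemma ms_pos: "m > 0" "s > 0"
  using n a b s m by (auto intro: Nat.gr0I)

lemma m_real: "2 * real m = real n * real a + (real n + 1) * real b"
  using arg_cong[OF m, of real] by (simp add: algebra_simps)

lemma muffin_n_eq: "muffin_n m s = n"
proof -
  have "2 * real m / real s = n + b / s"
    using a s unfolding m_real by (simp add: field_simps)
  moreover have "0 \<le> b / s" "b / s < 1" using a s by auto
  ultimately have "\<lfloor>2 * real m / real s\<rfloor> = int n" by linarith
  then show ?thesis by (simp add: muffin_n_def)
qed

text \<open>Students below \<open>a\<close> (short) get \<open>n\<close> pieces and the others
  (long) \<open>n + 1\<close>; their demands are \<open>- b\<close> and \<open>a\<close>.\<close>

lemma fully_feasible_solution:
  fixes t U V :: real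
  assumes io: "(\<Sum>k<s. out k) = (\<Sum>k<s. inn k)" and "0 \<le> t" and "t < s" and W: "W \<subseteq> {..<s}"
    and deg: "\<And>k. k < s \<Longrightarrow> out k + inn k + 2 * of_bool (k \<in> W) \<le> (if k < a then n else n + 1)"
    and W_net: "\<And>k. k \<in> W \<Longrightarrow> - V \<le> (if k < a then - real b else a) - t * (real (out k) - real (inn k))
       \<and> (if k < a then - real b else a) - t * (real (out k) - real (inn k)) \<le> U"
    and nW_net: "\<And>k. k < s \<Longrightarrow> k \<notin> W \<Longrightarrow> t * (real (out k) - real (inn k)) = (if k < a then - real b else a)"
    and UV: "U \<ge> 0" "V \<ge> 0" "0 < U + V" "U + V \<le> 2 * real s"
  obtains p f c where "fully_feasible m s p f" "2 * c < U + V"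
    "1/2 - max t c / (2 * real s) \<le> min_piece m p"
proof -
  define D where "D k = (if k < a then n else n + 1)" for k
  have res: "real s * D k - 2 * real m = (if k < a then - real b else a)" for k
    unfolding m_real s D_def by (simp add: algebra_simps)
  have "(\<Sum>k<s. D k) = 2 * m"
    unfolding m s D_def lessThan_atLeast0 sum_if_less by simp
  then have "\<exists>p f c. supply_feasible m s p f \<and> (\<forall>k<s. card {q\<in>pieces m. f q = k} = D k)
    \<and> 2 * c < U + V \<and> 1/2 - max t c / (2 * real s) \<le> min_piece m p"
    using assms res ms_pos by (intro solution_of_degrees[of m s D out inn t W V U]) (simp_all add: D_def)
  then obtain p f c where "supply_feasible m s p f" and card: "\<forall>k<s. card {q\<in>pieces m. f q = k} = D k"
    and "2 * c < U + V" "1/2 - max t c / (2 * real s) \<le> min_piece m p"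
    by blast
  moreover have "\<forall>k<s. card {q\<in>pieces m. f q = k} \<in> {n, n + 1}"
    using card by (simp add: D_def)
  ultimately show ?thesis by (intro that[of p f c]) (simp_all add: fully_feasible_def muffin_n_eq)
qed

section \<open>Fully-constrained solutions in four ranges of \<open>a\<close> and
  \<open>b\<close>\<close>

text \<open>Every short student receives flow \<open>t = b / n\<close> on all its \<open>n\<close>
  ends. The \<open>a * n\<close> sending ends are spread evenly over the long students, which keep
  two ends each for the cycle. Their residual demands lie in an interval of length \<open>t\<close>,
  so the cycle does not exceed \<open>t\<close>.\<close>

lemma few_long_students:
  assumes "a * n + b \<le> b * n"
  shows "\<exists>p f. fully_feasible m s p f \<and> 1/2 - (b / n) / (2 * real s) \<le> min_piece m p"
proof -
  obtain q R where qR: "a * n = q * b + R" "0 < R" "R \<le> b"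
    using even_distribution[of "a * n" b] a b n by auto
  have "(q + 1) * b < n * b" using assms qR by (simp add: algebra_simps)
  then have q: "q + 2 \<le> n" unfolding mult_less_cancel2 by simp
  define t where "t = real b / n"
  have t: "t * n = b" "t > 0" using n b by (simp_all add: t_def)
  have "t * 1 \<le> t * n" using n t(2) by (intro mult_left_mono) auto
  then have ts: "t < s" using t a s by simp
  define out where "out k = (if k < a then 0 else if k < a + R then q + 1 else q)" for k
  define inn where "inn k = (if k < a then n else 0)" for k
  have qRr: "real a * n = q * b + R" using arg_cong[OF qR(1), of real] by simp
  have e: "n * (t * q) = real q * b" unfolding t(1)[symmetric] by (simp add: algebra_simps)
  have "n * (t * q) \<le> n * real a" unfolding e using qRr by (simp add: mult.commute)
  then have U: "t * q \<le> a" using n by simp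
  have "n * (t * q + t) = real q * b + b" unfolding t(1)[symmetric] by (simp add: algebra_simps)
  then have "n * (t * q + t) \<ge> n * real a" using qR(3) qRr by (simp add: mult.commute)
  then have V: "t * q + t \<ge> a" using n by simp
  obtain p f c where "fully_feasible m s p f" "2 * c < (a - t * q) + (t * q + t - a)"
    "1/2 - max t c / (2 * real s) \<le> min_piece m p"
  proof (rule fully_feasible_solution[of out inn t "{a..<s}" "t * q + t - a" "a - t * q"])
    show "(\<Sum>k<s. out k) = (\<Sum>k<s. inn k)"
      unfolding out_def inn_def lessThan_atLeast0 sum_if_less using qR s
      by (simp add: algebra_simps min_def max_def)
  qed (use q t ts U V s in \<open>auto simp: out_def inn_def algebra_simps\<close>)
  moreover have "max t c = t" using \<open>2 * c < _\<close> t by simp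
  ultimately show ?thesis unfolding t_def by auto
qed

text \<open>Mirror image: the long students send \<open>a / (n + 1)\<close> on all their ends, and
  the short students form the cycle.\<close>

lemma few_short_students:
  assumes "b * (n + 1) + 2 * a \<le> a * n"
  shows "\<exists>p f. fully_feasible m s p f \<and> 1/2 - (a / (n + 1)) / (2 * real s) \<le> min_piece m p"
proof -
  obtain q R where qR: "b * (n + 1) = q * a + R" "0 < R" "R \<le> a"
    using even_distribution[of "b * (n + 1)" a] a b n by auto
  have "(q + 2) * a < n * a" using assms qR by (simp add: algebra_simps)
  then have q: "q + 3 \<le> n" unfolding mult_less_cancel2 by simp
  define t where "t = real a / (n + 1)"
  have t: "t * (n + 1) = a" "t > 0" using n a by (simp_all add: t_def)
  have "t * 1 \<le> t * (n + 1)" using n t(2) by (intro mult_left_mono) auto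
  then have ts: "t < s" unfolding t(1) using b s by simp
  define inn where "inn k = (if k < R then q + 1 else if k < a then q else 0)" for k
  define out where "out k = (if k < a then 0 else n + 1)" for k
  have qRr: "(n + 1) * real b = real q * a + R" using arg_cong[OF qR(1), of real] by (simp add: algebra_simps)
  have e: "(n + 1) * (t * q) = real q * a" unfolding t(1)[symmetric] by (simp add: algebra_simps)
  have "(n + 1) * (t * q) \<le> (n + 1) * real b" unfolding e qRr by simp
  then have V: "t * q \<le> b" by (simp only: mult_le_cancel_left_pos)
  have e': "(n + 1) * (t * q + t) = real q * a + a" unfolding t(1)[symmetric] by (simp add: algebra_simps)
  have "(n + 1) * (t * q + t) \<ge> (n + 1) * real b" unfolding e' qRr using qR(3) by simp
  then have U: "t * q + t \<ge> b" by (simp only: mult_le_cancel_left_pos)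
  obtain p f c where "fully_feasible m s p f" "2 * c < (t * q + t - b) + (b - t * q)"
    "1/2 - max t c / (2 * real s) \<le> min_piece m p"
  proof (rule fully_feasible_solution[of out inn t "{..<a}" "b - t * q" "t * q + t - b"])
    show "(\<Sum>k<s. out k) = (\<Sum>k<s. inn k)"
      unfolding out_def inn_def lessThan_atLeast0 sum_if_less using qR s
      by (simp add: algebra_simps min_def max_def)
  qed (use q t ts U V s qR in \<open>auto simp: out_def inn_def algebra_simps\<close>)
  moreover have "max t c = t" using \<open>2 * c < _\<close> t by simp
  ultimately show ?thesis unfolding t_def by auto
qed

text \<open>Every long student sends along \<open>n - 1\<close> edges and joins the cycle with
  residual \<open>a - (n - 1) * t\<close>. To match the number of ends, \<open>a'\<close> short
  students receive along only \<open>n - 2\<close> edges and join with residual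
  \<open>- 2 * t\<close>.\<close>

lemma more_long_students:
  assumes "a * n + b \<le> b * n + 2 * a" and "b * n \<le> a * n + b"
  shows "\<exists>p f c. fully_feasible m s p f \<and> 2 * c < a - (real n - 3) * (b / n)
    \<and> 1/2 - max (b / n) c / (2 * real s) \<le> min_piece m p"
proof -
  \<comment> \<open>\<open>a' = (an - b(n-1))/2\<close> without halving, using \<open>2m = na + (n+1)b\<close>\<close>
  define a' where "a' = m - b * n"
  have a': "2 * a' + b * n = a * n + b" "a' \<le> a"
    using assms m by (auto simp: a'_def algebra_simps)
  define t where "t = real b / n"
  have t: "t * n = b" "t > 0" using n b by (simp_all add: t_def)
  have "t * 2 \<le> t * n" using n t(2) by (intro mult_left_mono) auto
  then have ts: "t < s" "2 * t \<le> b" using t a s by simp_all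
  define out where "out k = (if k < a then 0 else n - 1)" for k
  define inn where "inn k = (if k < a' then n - 2 else if k < a then n else 0)" for k
  have nr: "real (n - 1) = real n - 1" "real (n - 2) = real n - 2" using n by (auto simp: of_nat_diff)
  have "n * ((real n - 1) * t) = real b * n - b" using t by (simp add: algebra_simps)
  also have "\<dots> \<le> n * real a"
    using assms(2) by (simp add: algebra_simps flip: of_nat_mult of_nat_add)
  finally have U: "(real n - 1) * t \<le> a" using n by simp
  obtain N a'' where N: "n = N + 2" "a = a' + a''"
    using n a'(2) by (metis le_add_diff_inverse2 le_Suc_ex)
  obtain p f c where "fully_feasible m s p f" "2 * c < (a - (real n - 1) * t) + 2 * t"
    "1/2 - max t c / (2 * real s) \<le> min_piece m p"
  proof (rule fully_feasible_solution[of out inn t "{..<a'} \<union> {a..<s}" "2 * t" "a - (real n - 1) * t"])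
    show "(\<Sum>k<s. out k) = (\<Sum>k<s. inn k)"
      unfolding out_def inn_def lessThan_atLeast0 sum_if_less using a' s N
      by (simp add: algebra_simps min_def max_def)
    show "(a - (real n - 1) * t) + 2 * t \<le> 2 * real s"
    proof -
      have "(real n - 1) * t \<ge> 0" using n t by simp
      then show ?thesis using ts s by simp
    qed
  qed (use n a' t ts U s nr in \<open>auto simp: out_def inn_def algebra_simps\<close>)
  moreover from this(2) have "2 * c < a - (real n - 3) * t" by (simp add: algebra_simps)
  ultimately show ?thesis unfolding t_def by blast
qed

text \<open>Mirror image: every short student receives along \<open>n - 2\<close> edges and joins
  the cycle with residual \<open>(n - 2) * t - b\<close>, as do \<open>b'\<close> long students that
  send along \<open>n - 1\<close> edges, with residual \<open>2 * t\<close>.\<close>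

lemma more_short_students:
  assumes "b * n + 2 * a \<le> a * n + b" and "a * n \<le> b * n + b + 2 * a"
  shows "\<exists>p f c. fully_feasible m s p f \<and> 2 * c < b - (real n - 4) * (a / (n + 1))
    \<and> 1/2 - max (a / (n + 1)) c / (2 * real s) \<le> min_piece m p"
proof -
  \<comment> \<open>\<open>b' = (b(n+1) - a(n-2))/2\<close> without halving\<close>
  define b' where "b' = m + a - a * n"
  have b': "2 * b' + a * n = b * n + b + 2 * a" "b' \<le> b"
    using assms m by (auto simp: b'_def algebra_simps)
  define t where "t = real a / (n + 1)"
  have t: "t * (n + 1) = a" "t > 0" using n a by (simp_all add: t_def)
  have "t * 2 \<le> t * (n + 1)" using n t(2) by (intro mult_left_mono) auto
  then have ts: "t < s" "2 * t \<le> a" unfolding t(1) using t(2) b s by simp_all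
  define out where "out k = (if k < a then 0 else if k < a + b' then n - 1 else n + 1)" for k
  define inn where "inn k = (if k < a then n - 2 else 0)" for k
  have nr: "real (n - 1) = real n - 1" "real (n - 2) = real n - 2" using n by (auto simp: of_nat_diff)
  have "(n + 1) * ((real n - 2) * t) = (real n - 2) * a"
    unfolding t(1)[symmetric] by (simp add: algebra_simps)
  also have "\<dots> \<le> (n + 1) * real b" using assms(2) by (simp add: algebra_simps flip: of_nat_mult of_nat_add)
  finally have V: "(real n - 2) * t \<le> b" by (simp only: mult_le_cancel_left_pos)
  obtain N b'' where N: "n = N + 2" "b = b' + b''"
    using n b'(2) by (metis le_add_diff_inverse2 le_Suc_ex)
  obtain p f c where "fully_feasible m s p f" "2 * c < 2 * t + (b - (real n - 2) * t)"
    "1/2 - max t c / (2 * real s) \<le> min_piece m p"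
  proof (rule fully_feasible_solution[of out inn t "{..<a + b'}" "b - (real n - 2) * t" "2 * t"])
    show "(\<Sum>k<s. out k) = (\<Sum>k<s. inn k)"
      unfolding out_def inn_def lessThan_atLeast0 sum_if_less using b' s N
      by (simp add: algebra_simps min_def max_def)
    show "2 * t + (b - (real n - 2) * t) \<le> 2 * real s"
    proof -
      have "(real n - 2) * t \<ge> 0" using n t by simp
      then show ?thesis using ts s by simp
    qed
  qed (use n b' t ts V s nr in \<open>auto simp: out_def inn_def algebra_simps\<close>)
  moreover from this(2) have "2 * c < b - (real n - 4) * t" by (simp add: algebra_simps)
  ultimately show ?thesis unfolding t_def by blast
qed


section \<open>Attaining the bound with an overloaded student\<close>

text \<open>One long student drops to \<open>n\<close> pieces and another, \<open>z\<close>, rises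
  to \<open>n + 2\<close>, with demand \<open>2 * a + b\<close>. The \<open>a + 1\<close> short
  students receive \<open>t = b / n\<close> on every end; other long students send along at most one
  base edge each. The cases depend on how many of these there are.\<close>

lemma solution_with_overloaded_student:
  assumes "n * a \<le> b"
  shows "\<exists>p f. supply_feasible m s p f \<and> (\<exists>k<s. card {q\<in>pieces m. f q = k} = n + 2)
    \<and> 1/2 - (b / n) / (2 * real s) \<le> min_piece m p"
proof -
  have "2 * 1 \<le> n * a" using n a by (intro mult_le_mono) auto
  then have "2 \<le> b" using assms by simp
  then obtain b' where b': "b = b' + 2" using le_Suc_ex by (metis add.commute)
  define z where "z = a + 1 + b'"
  have z: "s = z + 1" using s b' by (simp add: z_def)
  have az: "Suc a \<le> z" "z - Suc a = b'" by (simp_all add: z_def)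
  define D where "D k = (if k < a + 1 then n else if k < z then n + 1 else n + 2)" for k
  have res: "real s * D k - 2 * real m = (if k < a + 1 then - real b else if k < z then real a else 2 * real a + real b)" for k
    unfolding m_real s D_def by (simp add: algebra_simps)
  have D: "(\<Sum>k<s. D k) = 2 * m"
    unfolding m z D_def lessThan_atLeast0 sum_if_less using b' by (simp add: z_def algebra_simps)
  define t where "t = real b / n"
  have t: "t * n = b" "t > 0" using n b by (simp_all add: t_def)
  have "t * 2 \<le> t * n" using n t(2) by (intro mult_left_mono) auto
  then have ts: "t < s" "2 * t \<le> b" using t a s by simp_all
  have "n * real a \<le> b" using assms by (simp flip: of_nat_mult)
  then have ta: "a \<le> t" unfolding t_def using n by (simp add: field_simps)
  define inn where "inn k = (if k < a + 1 then n else 0)" for k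
  have main: ?thesis if ex: "\<exists>p f c. supply_feasible m s p f \<and> (\<forall>k<s. card {q\<in>pieces m. f q = k} = D k)
    \<and> 2 * c < C \<and> 1/2 - max t c / (2 * real s) \<le> min_piece m p" and "C \<le> 2 * t" for C
  proof -
    from ex obtain p f c where *: "supply_feasible m s p f" "\<forall>k<s. card {q\<in>pieces m. f q = k} = D k"
      "2 * c < C" "1/2 - max t c / (2 * real s) \<le> min_piece m p" by blast
    then have "max t c = t" using \<open>C \<le> 2 * t\<close> by simp
    moreover have "D z = n + 2" "z < s" by (simp_all add: D_def z z_def)
    ultimately show ?thesis using *
      by (intro exI[of _ p] exI[of _ f]) (auto simp: t_def intro!: exI[of _ z])
  qed
  have "n * a \<le> b' \<or> b = n * a + 1 \<or> b = n * a" using assms b' by linarith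
  then consider "n * a \<le> b'" | "b = n * a + 1" | "b = n * a" by blast
  then show ?thesis
  proof cases
    case 1
    \<comment> \<open>Of the \<open>n * (a + 1)\<close> sending ends \<open>z\<close> supplies
      \<open>n\<close>, and \<open>n * a\<close> long students supply one each; all students from
      \<open>a + 1\<close> on join the cycle.\<close>
    define out where "out k = (if k < a + 1 then 0 else if k < a + 1 + n * a then 1 else if k < z then 0 else n)" for k
    show ?thesis
    proof (rule main, rule solution_of_degrees[of m s D out inn t "{a + 1..<s}" "t - a" "2 * real a"], unfold res)
      show "(\<Sum>k<s. D k) = 2 * m" by (rule D)
      show "(\<Sum>k<s. out k) = (\<Sum>k<s. inn k)"
        unfolding out_def inn_def lessThan_atLeast0 sum_if_less z using 1
        by (simp add: z_def min_def max_def algebra_simps)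
    qed (use ms_pos 1 n t ts ta s z in \<open>auto simp: out_def inn_def D_def z_def algebra_simps\<close>)
  next
    case 2
    \<comment> \<open>By parity. Student \<open>a + 1\<close> will use four of its
      \<open>n + 1\<close> ends: a base edge, an extra edge and two cycle ends.\<close>
    have "n \<ge> 3"
    proof (rule ccontr)
      assume "\<not> n \<ge> 3"
      then have "n = 2" using n by simp
      then have "2 * m = 8 * a + 3" using m 2 by simp
      then show False by presburger
    qed
    define out where "out k = (if k < a + 1 then 0 else if k < z then 1 else n + 1)" for k
    have io: "(\<Sum>k<s. out k) = (\<Sum>k<s. inn k)"
      unfolding out_def inn_def lessThan_atLeast0 sum_if_less z using 2 b' az
      by (simp add: algebra_simps)
    obtain es where es: "edges_on s t es" "\<And>k. k < s \<Longrightarrow> deg es k = out k + inn k"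
      "\<And>k. k < s \<Longrightarrow> net es k = t * (real (out k) - real (inn k))"
      using edges_with_degrees[OF io less_imp_le[OF t(2)]] by blast
    have "t = a + 1 / n" using n by (simp add: t_def 2 field_simps)
    also have "1 \<le> real (n * a)" using \<open>2 * 1 \<le> n * a\<close> by linarith
    then have "a + 1 / n \<le> 2 * real a" using n by (simp add: field_simps)
    finally have ta2: "t \<le> 2 * a" by simp
    have "Suc a < z" using 2 b' \<open>2 * 1 \<le> n * a\<close> by (simp add: z_def)
    have es_deg: "deg es k = (if k < a + 1 then n else if k < z then 1 else n + 1)"
      and es_net: "net es k = (if k < a + 1 then - real b else if k < z then t else t + b)" if "k < s" for k
      using es(2,3)[OF that] t(1) by (auto simp: out_def inn_def algebra_simps)
    \<comment> \<open>student \<open>z\<close> has only one end left and cannot join the cycle, so an extra edge from \<open>z\<close> to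
      student \<open>a + 1\<close> carries its surplus\<close>
    show ?thesis
    proof (rule main, rule solution_with_cycle[of m s D t "(z, a + 1, 2 * a - t) # es" "{a + 1..<z}" "t - a" "a"], unfold res)
      show "(\<Sum>k<s. D k) = 2 * m" by (rule D)
      show "edges_on s t ((z, a + 1, 2 * a - t) # es)"
        using es(1) ta ta2 \<open>Suc a < z\<close> z by (auto simp: edges_on_def)
    qed (use ms_pos \<open>n \<ge> 3\<close> \<open>Suc a < z\<close> a t ts ta ta2 s z in
        \<open>auto simp: D_def es_deg es_net less_Suc_eq\<close>)
  next
    case 3
    have "t = a" using n by (simp add: t_def 3)
    define out where "out k = (if k < a + 1 then 0 else if k < z then 1 else n + 2)" for k
    \<comment> \<open>Since \<open>t = a\<close>, the base edges meet all demands exactly and no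
      cycle is left; \<open>0\<close> and \<open>1\<close> are placeholders for its bounds.\<close>
    show ?thesis
    proof (rule main, rule solution_of_degrees[of m s D out inn t "{}" 0 1], unfold res)
      show "(\<Sum>k<s. D k) = 2 * m" by (rule D)
      show "(\<Sum>k<s. out k) = (\<Sum>k<s. inn k)"
        unfolding out_def inn_def lessThan_atLeast0 sum_if_less z using 3 b' az
        by (simp add: algebra_simps)
    qed (use ms_pos n a t ts \<open>t = a\<close> 3 s z in \<open>auto simp: out_def inn_def D_def z_def algebra_simps\<close>)
  qed
qed

section \<open>Comparison with the bounds for other piece counts\<close>

text \<open>The demand of a student with \<open>n + 2\<close> pieces is \<open>2 * a + b\<close>, so
  the threshold for \<open>C\<close> is the average flow on its ends.\<close>

lemma bound_n2: "C < (2 * real a + b) / (n + 2) \<Longrightarrow> real m / s / (n + 2) < 1/2 - C / (2 * real s)"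
proof -
  assume "C < (2 * real a + b) / (n + 2)"
  also have "(2 * real a + b) / (n + 2) = s - 2 * real m / (n + 2)"
    unfolding m_real s by (simp add: field_simps)
  finally have "C / (2 * real s) < (s - 2 * real m / (n + 2)) / (2 * real s)"
    using ms_pos by (intro divide_strict_right_mono) auto
  also have "\<dots> = 1/2 - real m / s / (n + 2)"
    using ms_pos by (simp add: diff_divide_distrib mult.commute)
  finally show ?thesis by simp
qed

text \<open>Likewise for a student with \<open>n - 1\<close> pieces, whose demand is
  \<open>- (a + 2 * b)\<close>.\<close>

lemma bound_n1: "C < (real a + 2 * b) / (real n - 1) \<Longrightarrow> 1 - real m / s / (real n - 1) < 1/2 - C / (2 * real s)"
proof -
  assume "C < (real a + 2 * b) / (real n - 1)"
  also have "(real a + 2 * b) / (real n - 1) = 2 * real m / (real n - 1) - s"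
    unfolding m_real s using n by (simp add: field_simps)
  finally have "C / (2 * real s) < (2 * real m / (real n - 1) - s) / (2 * real s)"
    using ms_pos by (intro divide_strict_right_mono) auto
  also have "\<dots> = real m / s / (real n - 1) - 1/2"
    using ms_pos by (simp add: diff_divide_distrib mult.commute)
  finally show ?thesis by simp
qed

lemma bound_n: "1/2 - (b / n) / (2 * real s) = 1 - real m / s / n"
proof -
  have "real m = (n * s + b) / 2" using m_real by (simp add: s algebra_simps)
  show ?thesis unfolding \<open>real m = _\<close> using ms_pos n by (simp add: field_simps)
qed

lemma threshold_iff:
  "real n * (real n + 2) / (2 * (real n + 1)) \<le> real m / real s \<longleftrightarrow> n * a \<le> b"
proof -
  have "real n * (real n + 2) / (2 * (real n + 1)) \<le> real m / real s
      \<longleftrightarrow> real n * (real n + 2) * s \<le> (real n + 1) * (2 * real m)"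
    using ms_pos by (simp add: field_simps)
  also have "\<dots> \<longleftrightarrow> n * real a \<le> b"
    unfolding m_real s by (simp add: algebra_simps)
  finally show ?thesis by (simp flip: of_nat_mult)
qed


text \<open>The four constructions cover all \<open>a\<close> and \<open>b\<close>. The hypothesis
  puts \<open>b / n\<close> below \<open>(2 * a + b) / (n + 2)\<close>.\<close>

lemma fully_feasible_below_threshold:
  assumes "b < n * a"
  shows "\<exists>p f. fully_feasible m s p f \<and> real m / s / (n + 2) < min_piece m p
    \<and> 1 - real m / s / (real n - 1) < min_piece m p"
proof -
  have main: ?thesis if "fully_feasible m s p f" "1/2 - C / (2 * real s) \<le> min_piece m p"
     "C < (2 * real a + b) / (n + 2)" "C < (real a + 2 * b) / (real n - 1)" for p f C
    using bound_n2[OF that(3)] bound_n1[OF that(4)] that(1,2) by fastforce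
  have n_pos: "real n > 0" "real n - 1 > 0" "real n + 1 > 0" using n by auto
  have ba: "real b < n * real a" using assms by (simp flip: of_nat_mult)
  have long: "b / n < (2 * real a + b) / (n + 2)" "b / n < (real a + 2 * b) / (real n - 1)"
  proof -
    have "real b * (n + 2) < (2 * real a + b) * n" using ba by (simp add: algebra_simps)
    then show "b / n < (2 * real a + b) / (n + 2)" using n by (simp add: frac_less_eq divide_less_eq less_divide_eq field_simps)
    have "real b * (real n - 1) < (real a + 2 * b) * n"
      using n_pos a b by (simp add: algebra_simps add_pos_nonneg)
    then show "b / n < (real a + 2 * b) / (real n - 1)" using n_pos by (simp add: field_simps)
  qed
  have short: "a / (n + 1) < (2 * real a + b) / (n + 2)" "a / (n + 1) < (real a + 2 * b) / (real n - 1)"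
  proof -
    have "real a * (n + 2) < (2 * real a + b) * (n + 1)" using n_pos a b by (simp add: algebra_simps add_pos_nonneg)
    then show "a / (n + 1) < (2 * real a + b) / (n + 2)" by (simp add: field_simps)
    have "real a * (real n - 1) < (real a + 2 * b) * (n + 1)"
      using n_pos a b by (simp add: algebra_simps add_pos_nonneg)
    then show "a / (n + 1) < (real a + 2 * b) / (real n - 1)" using n_pos by (simp add: field_simps)
  qed
  consider "a * n + b \<le> b * n" | "b * n \<le> a * n + b" "a * n + b \<le> b * n + 2 * a"
    | "b * n + 2 * a \<le> a * n + b" "a * n \<le> b * n + b + 2 * a" | "b * (n + 1) + 2 * a \<le> a * n"
    by (simp add: algebra_simps) linarith
  then show ?thesis
  proof cases
    case 1
    then show ?thesis using few_long_students main long by blast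
  next
    case 2
    obtain p f c where *: "fully_feasible m s p f" "2 * c < a - (real n - 3) * (b / n)"
      "1/2 - max (b / n) c / (2 * real s) \<le> min_piece m p"
      using more_long_students 2 by blast
    have an: "real a * (real n - 2) \<le> b * (real n - 1)"
      using 2(2) by (simp add: algebra_simps flip: of_nat_mult of_nat_add)
    have c: "2 * c * n < a * n - (real n - 3) * b"
      using *(2) n_pos by (simp add: field_simps)
    \<comment> \<open>Given the bound on \<open>c\<close>, clearing denominators in
      \<open>c < (2 * a + b) / (n + 2)\<close> leads to this inequality. The one for
      \<open>(a + 2 * b) / (n - 1)\<close> below arises in the same way.\<close>
    have "a * n * (real n - 2) \<le> b * (real n + 3) * (real n - 2)"
    proof (cases "n = 2")
      case False
      have "a * n * (real n - 2) \<le> n * (b * (real n - 1))"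
        using mult_left_mono[OF an, of n] by (simp add: algebra_simps)
      also have "\<dots> \<le> b * (real n + 3) * (real n - 2)"
        using False n b by (simp add: algebra_simps)
      finally show ?thesis .
    qed simp
    moreover have "(2 * c * n) * (n + 2) < (a * n - (real n - 3) * b) * (n + 2)"
      using c by (intro mult_strict_right_mono) auto
    ultimately have "n * (2 * (c * (n + 2))) < n * (2 * (2 * real a + b))"
      by (simp add: algebra_simps)
    then have c2: "c < (2 * real a + b) / (n + 2)" using n_pos by (simp add: less_divide_eq)
    have "a * n * (real n - 3) \<le> b * (n^2 + 3)"
    proof (cases "n = 2")
      case False
      have "a * n * (real n - 3) \<le> a * n * (real n - 2)" by (intro mult_left_mono) auto
      also have "\<dots> \<le> n * (b * (real n - 1))"
        using mult_left_mono[OF an, of n] by (simp add: algebra_simps)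
      also have "\<dots> \<le> b * (n^2 + 3)"
        using n by (simp add: algebra_simps power2_eq_square)
      finally show ?thesis .
    qed (simp add: order_trans[of _ 0])
    moreover have "(2 * c * n) * (real n - 1) < (a * n - (real n - 3) * b) * (real n - 1)"
      using c n_pos by (intro mult_strict_right_mono) auto
    ultimately have "n * (2 * (c * (real n - 1))) < n * (2 * (real a + 2 * b))"
      by (simp add: algebra_simps power2_eq_square)
    then have "c < (real a + 2 * b) / (real n - 1)" using n_pos by (simp add: less_divide_eq)
    then show ?thesis using main[OF *(1,3)] long c2 by simp
  next
    case 3
    obtain p f c where *: "fully_feasible m s p f" "2 * c < b - (real n - 4) * (a / (n + 1))"
      "1/2 - max (a / (n + 1)) c / (2 * real s) \<le> min_piece m p"
      using more_short_students 3 by blast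
    have bn: "real b * (real n - 1) \<le> a * (real n - 2)"
      using 3(1) by (simp add: algebra_simps flip: of_nat_mult of_nat_add)
    have "n \<noteq> 2" using 3(1) b by auto
    then have n3: "real n \<ge> 3" using n by simp
    have c: "2 * c * (real n + 1) < b * (real n + 1) - (real n - 4) * a"
      using *(2) n_pos by (simp add: field_simps)
    \<comment> \<open>The factor \<open>n - 1\<close> makes \<open>bn\<close> applicable; the sides
      of the remaining inequality in \<open>n\<close> differ by
      \<open>2 * ((n - 1)^2 + 1)\<close>.\<close>
    have "(real n - 1) * (b * (real n + 1) * n) \<le> (real n - 1) * (a * (n^2 + 2 * real n - 4))"
    proof -
      have "(real n - 1) * (b * (real n + 1) * n) \<le> (a * (real n - 2)) * ((real n + 1) * n)"
        using mult_right_mono[OF bn, of "(real n + 1) * n"] by (simp add: algebra_simps)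
      also have "\<dots> = a * ((real n - 2) * ((real n + 1) * n))" by simp
      also have "\<dots> \<le> a * ((real n - 1) * (n^2 + 2 * real n - 4))"
      proof (intro mult_left_mono)
        have "0 \<le> (real n - 1)^2 + 1" by simp
        then show "(real n - 2) * ((real n + 1) * n) \<le> (real n - 1) * (n^2 + 2 * real n - 4)"
          by (simp add: algebra_simps power2_eq_square)
      qed simp
      finally show ?thesis by (simp add: algebra_simps)
    qed
    then have "b * (real n + 1) * n \<le> a * (n^2 + 2 * real n - 4)" using n_pos by simp
    moreover have "(2 * c * (real n + 1)) * (n + 2) < (b * (real n + 1) - (real n - 4) * a) * (n + 2)"
      using c by (intro mult_strict_right_mono) auto
    ultimately have "(real n + 1) * (2 * (c * (n + 2))) < (real n + 1) * (2 * (2 * real a + b))"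
      by (simp add: algebra_simps power2_eq_square)
    then have c2: "c < (2 * real a + b) / (n + 2)" using n_pos by (simp add: less_divide_eq)
    have "b * (real n + 1) * (real n - 5) \<le> a * (n^2 - 3 * real n + 6)"
    proof (cases "n \<ge> 5")
      case True
      have "0 \<le> (real n + 1) * (real n - 5)" using True by simp
      from mult_right_mono[OF bn this]
      have "(real n - 1) * (b * (real n + 1) * (real n - 5)) \<le> (a * (real n - 2)) * ((real n + 1) * (real n - 5))"
        by (simp add: algebra_simps)
      also have "\<dots> = a * ((real n - 2) * ((real n + 1) * (real n - 5)))" by simp
      also have "\<dots> \<le> a * ((real n - 1) * (n^2 - 3 * real n + 6))"
      proof (intro mult_left_mono)
        \<comment> \<open>This is the difference \<open>2 * n^2 + 6 * n - 16\<close> of the two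
          sides below, arranged so that \<open>n \<ge> 3\<close> shows its sign.\<close>
        have "0 \<le> 2 * (real n * (real n - 3)) + 12 * (real n - 3) + 20"
          using n3 by (intro add_nonneg_nonneg mult_nonneg_nonneg) auto
        then show "(real n - 2) * ((real n + 1) * (real n - 5)) \<le> (real n - 1) * (n^2 - 3 * real n + 6)"
          using n3 by (simp add: algebra_simps power2_eq_square)
      qed simp
      finally have "(real n - 1) * (b * (real n + 1) * (real n - 5)) \<le> (real n - 1) * (a * (n^2 - 3 * real n + 6))"
        by (simp add: algebra_simps)
      then show ?thesis using n_pos by simp
    next
      case False
      then have "b * (real n + 1) * (real n - 5) \<le> 0" by (intro mult_nonneg_nonpos) auto
      also have "0 \<le> real n * (real n - 3) + 6" using n3 by simp
      then have "0 \<le> a * (n^2 - 3 * real n + 6)"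
        by (intro mult_nonneg_nonneg) (auto simp: algebra_simps power2_eq_square)
      finally show ?thesis .
    qed
    moreover have "(2 * c * (real n + 1)) * (real n - 1) < (b * (real n + 1) - (real n - 4) * a) * (real n - 1)"
      using c n_pos by (intro mult_strict_right_mono) auto
    ultimately have "(real n + 1) * (2 * (c * (real n - 1))) < (real n + 1) * (2 * (real a + 2 * b))"
      by (simp add: algebra_simps power2_eq_square)
    then have "c < (real a + 2 * b) / (real n - 1)" using n_pos by (simp add: less_divide_eq)
    then show ?thesis using main[OF *(1,3)] short c2 by simp
  next
    case 4
    then show ?thesis using few_short_students main short by blast
  qed
qed

section \<open>Optimality\<close>

lemma not_fully_feasible_min_piece:
  assumes "supply_feasible m s p f" and "\<not> fully_feasible m s p f"
  shows "min_piece m p \<le> real m / s / (n + 2) \<or> min_piece m p \<le> 1 - real m / s / (real n - 1)"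
proof -
  obtain k where k: "k < s" "card {q\<in>pieces m. f q = k} \<notin> {n, n + 1}"
    using assms by (auto simp: fully_feasible_def muffin_n_eq)
  then have "n + 2 \<le> card {q\<in>pieces m. f q = k} \<or> card {q\<in>pieces m. f q = k} \<le> n - 1"
    by auto
  then show ?thesis
    using min_piece_many_pieces[OF assms(1) k(1), of "n + 2"]
      min_piece_few_pieces[OF assms(1) k(1), of "n - 1"] ms_pos n
    by (auto simp: of_nat_diff)
qed

text \<open>There are \<open>2 * m = (n + 1) * s - a\<close> pieces, too few for every student to
  have \<open>n + 1\<close>.\<close>

lemma supply_feasible_min_piece:
  assumes "supply_feasible m s p f"
  shows "min_piece m p \<le> 1 - real m / s / n"
proof -
  have "\<exists>k<s. card {q\<in>pieces m. f q = k} \<le> n"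
  proof (rule ccontr)
    assume "\<not> ?thesis"
    then have "(\<Sum>k<s. n + 1) \<le> (\<Sum>k<s. card {q\<in>pieces m. f q = k})"
      by (intro sum_mono) (auto simp: not_le Suc_le_eq)
    then have "s * (n + 1) \<le> 2 * m" using sum_card_at_students[OF assms] by simp
    then show False using m s a by (simp add: algebra_simps)
  qed
  then show ?thesis using min_piece_few_pieces[OF assms] ms_pos n by auto
qed

text \<open>If \<open>n * a \<le> b\<close>, both problems have the optimal value
  \<open>1 - m / s / n\<close>. Otherwise \<open>p0\<close> strictly beats every supply-constrained
  solution that is not fully-constrained, so both problems have the same optimal solutions.\<close>

lemma optimality:
  "(\<forall>p f. fully_optimal m s p f \<longrightarrow> supply_optimal m s p f)
    \<and> ((\<exists>p f. supply_optimal m s p f \<and> \<not> fully_feasible m s p f) \<longleftrightarrow> n * a \<le> b)"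
proof (cases "n * a \<le> b")
  case True
  have "1 * b + 1 * b \<le> b * n" using n by (simp flip: mult_2_right)
  then have "a * n + b \<le> b * n" using True by (simp add: mult.commute)
  from few_long_students[OF this] obtain p0 f0
    where p0: "fully_feasible m s p0 f0" "1 - real m / s / n \<le> min_piece m p0"
    unfolding bound_n by blast
  obtain p1 f1 k where p1: "supply_feasible m s p1 f1" "1 - real m / s / n \<le> min_piece m p1"
    and k: "k < s" "card {q\<in>pieces m. f1 q = k} = n + 2"
    using solution_with_overloaded_student[OF True] unfolding bound_n by blast
  have "supply_optimal m s p1 f1"
    unfolding supply_optimal_def using p1 supply_feasible_min_piece by (meson order_trans)
  moreover have "\<not> fully_feasible m s p1 f1"
    using k by (auto simp: fully_feasible_def muffin_n_eq)
  moreover have "supply_optimal m s p f" if "fully_optimal m s p f" for p f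
    unfolding supply_optimal_def
    using that p0 supply_feasible_min_piece unfolding fully_optimal_def fully_feasible_def
    by (meson order_trans)
  ultimately show ?thesis using True by blast
next
  case False
  then obtain p0 f0 where p0: "fully_feasible m s p0 f0" "real m / s / (n + 2) < min_piece m p0"
    "1 - real m / s / (real n - 1) < min_piece m p0"
    using fully_feasible_below_threshold by (auto simp: not_le)
  have lt: "min_piece m p < min_piece m p0" if "supply_feasible m s p f" "\<not> fully_feasible m s p f" for p f
    using not_fully_feasible_min_piece[OF that] p0 by linarith
  have "supply_optimal m s p f" if opt: "fully_optimal m s p f" for p f
    unfolding supply_optimal_def
  proof (intro conjI allI impI)
    show "supply_feasible m s p f" using opt by (simp add: fully_optimal_def fully_feasible_def)
    fix p' f' assume *: "supply_feasible m s p' f'"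
    have "min_piece m p0 \<le> min_piece m p" using opt p0 by (auto simp: fully_optimal_def)
    then show "min_piece m p' \<le> min_piece m p"
      using opt lt[OF *] by (cases "fully_feasible m s p' f'") (auto simp: fully_optimal_def)
  qed
  moreover have "fully_feasible m s p f" if "supply_optimal m s p f" for p f
  proof (rule ccontr)
    assume "\<not> ?thesis"
    moreover have "supply_feasible m s p f" using that by (simp add: supply_optimal_def)
    ultimately have "min_piece m p < min_piece m p0" by (rule lt[rotated])
    moreover have "supply_feasible m s p0 f0" using p0 by (simp add: fully_feasible_def)
    ultimately show False using that by (fastforce simp: supply_optimal_def)
  qed
  ultimately show ?thesis using False by blast
qed

end

theorem theorem11:
  fixes m s :: nat
  assumes "m > 0" and "s > 0"
    and "muffin_n m s \<ge> 2"
    and "2 * real m / real s \<notin> \<int>"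
  shows "(\<forall>p f. fully_optimal m s p f \<longrightarrow> supply_optimal m s p f) \<and>
         ((\<exists>p f. supply_optimal m s p f \<and> \<not> fully_feasible m s p f) \<longleftrightarrow>
            real (muffin_n m s) * (real (muffin_n m s) + 2) / (2 * (real (muffin_n m s) + 1))
              \<le> real m / real s \<and>
            real m / real s < (real (muffin_n m s) + 1) / 2)"
proof -
  define n where "n = muffin_n m s"
  \<comment> \<open>Here \<open>x\<close> is \<open>2 * m / s\<close>, twice a student's
    share.\<close>
  define x where "x = 2 * real m / real s"
  have "real n = of_int \<lfloor>x\<rfloor>" by (simp add: n_def muffin_n_def x_def)
  then have "real n \<le> x" "x < real n + 1" by linarith+
  moreover have "real n \<noteq> x" using assms(4) by (metis Ints_of_nat x_def)
  ultimately have *: "real n < x" "x < real n + 1" by auto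
  then have "real (n * s) < real (2 * m)" "real (2 * m) < real ((n + 1) * s)"
    using \<open>s > 0\<close> by (simp_all add: x_def field_simps)
  then have nm: "n * s < 2 * m" "2 * m < (n + 1) * s" by (simp_all only: of_nat_less_iff)
  \<comment> \<open>By \<open>nm\<close> both truncated differences are exact and positive; its
    strictness on the left comes from \<open>2 * m / s\<close> not being an integer.\<close>
  interpret muffin_numbers m s n "(n + 1) * s - 2 * m" "2 * m - n * s"
  proof
    have "(n + 1) * s = n * s + s" by simp
    then show "s = (n + 1) * s - 2 * m + (2 * m - n * s)" using nm by linarith
    obtain d e where "2 * m = n * s + d" "(n + 1) * s = 2 * m + e"
      using nm by (metis less_imp_le le_Suc_ex)
    moreover from this have "s = d + e" by simp
    ultimately show "2 * m = n * ((n + 1) * s - 2 * m) + (n + 1) * (2 * m - n * s)"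
      by (simp add: algebra_simps)
  qed (use nm assms(3) in \<open>auto simp: n_def\<close>)
  \<comment> \<open>The floor yields the upper bound in the condition on \<open>m / s\<close>;
    \<open>threshold_iff\<close> translates the lower one.\<close>
  have "real m / real s < (real n + 1) / 2" using *(2) by (simp add: x_def mult.commute)
  then show ?thesis using optimality threshold_iff unfolding n_def[symmetric] by blast
qed

end
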